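(* Let $U_1,\dots,U_m\subset\mathbb{R}^n$ be closed convex sets with $S:=\bigcap_{i=1}^m U_i\neq\varnothing$. Let $T:\mathbb{R}^n\to\mathbb{R}^n$ satisfy, for some constant $c_0\in(0,1]$, $$\|Ty-s\|^2\le\|y-s\|^2-c_0\,\delta(y)^2\qquad\text{for all } s\in S,\ y\in\mathbb{R}^n .$$ Let $\alpha_0\in(0,1]$ and let $(\alpha_k)_{k\ge1}$ satisfy: (i) $\alpha_k\in(0,1]$ for all $k\ge 1$; (ii) $\alpha_k\to0$; (iii) $L:=\limsup_{k\to\infty}\left(\frac1{\alpha_{k+1}}-\frac1{\alpha_k}\right)<2$; (iv) $\lim_{k\to\infty}\frac{\alpha_k}{\alpha_{k+1}}=1$. Let $x\in\mathbb{R}^n$ and let $(x_k)_{k\ge0}$ be generated by $x_0=x$ and $x_{k+1}=\alpha_k x+(1-\alpha_k)Tx_k$ for $k\ge0$. Suppose there are constants $\gamma\in(0,1]$ and $c\ge1$ such that the Hölder error bound $$\mathfrak d(z)\le c\,\delta(z)^{\gamma}$$ holds for all $z$ in a compact set containing all the iterates $x_k$. Then $$\limsup_{k\to\infty}\ \frac{\|x_k-P_S(x)\|}{\alpha_k^{\gamma/(4-2\gamma)}}\le\frac{c_0^{-\gamma/(4-2\gamma)}}{\left(2-\frac{1}{2\gamma^{-1}-1}\,L\right)^{1/2}}\,\bigl[2\,c\,\mathfrak d(x)\bigr]^{1/(2-\gamma)} .$$ In particular, $\|x_k-P_S(x)\|=\mathcal O\left(\alpha_k^{\gamma/(4-2\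gamma)}\right)$.
   Context: $\mathbb{R}^n$ is Euclidean space with norm $\|\cdot\|$. $\mathfrak d(z):=\mathrm{dist}(z,S)$ and $\delta(z):=\max_{1\le i\le m}\mathrm{dist}(z,U_i)$. $P_S(x)$ is the metric projection of $x$ onto $S$. *)

theory Defs
  imports "HOL-Analysis.Analysis" "HOL-Library.Landau_Symbols"
begin

text \<open>
  The function \<open>\<delta>\<close>: the largest distance to the sets \<open>U 1, \<dots>, U m\<close>.
  It is meant for \<open>m \<ge> 1\<close> and nonempty \<open>U i\<close>; \<^const>\<open>Max\<close> is unspecified on
  the empty set, and \<^const>\<open>infdist\<close> to the empty set is \<open>0\<close>.
\<close>
definition max_infdist :: "nat \<Rightarrow> (nat \<Rightarrow> 'a::metric_space set) \<Rightarrow> 'a \<Rightarrow> real" where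
  "max_infdist m U z = (MAX i\<in>{1..m}. infdist z (U i))"

end

theory Submission
  imports Defs
begin

text \<open>
  Write \<open>p\<close> for the projection of the anchor \<open>x\<close> onto \<open>S\<close>, \<open>d\<close> for the distance of \<open>x\<close> to \<open>S\<close>,
  \<open>e k\<close> for the squared distance of \<open>X k\<close> to \<open>p\<close>, and \<open>\<theta> = \<gamma> / (2 - \<gamma>)\<close>, so that the claimed rate
  for \<open>e k\<close> is \<open>\<alpha> k\<close> to the power \<open>\<theta>\<close>.

  The square of \<open>a (x - p) + (1 - a) (T y - p)\<close> has a cross term
  \<open>2 a (1 - a) (x - p) \<bullet> (T y - p)\<close>. As \<open>p\<close> is the projection of \<open>x\<close>, the inner product is at
  most \<open>d\<close> times the distance of \<open>T y\<close> to \<open>S\<close>, which does not exceed that of \<open>y\<close>, and the error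
  bound turns this into \<open>c d\<close> times \<open>\<delta>\<close> to the power \<open>\<gamma>\<close>. On the other side, \<open>T\<close> gains
  \<open>c0 \<delta>\<^sup>2\<close>. Whatever \<open>\<delta>\<close> is, the gain beats the cross term except for a remainder of
  order \<open>a\<close> to the power \<open>1 + \<theta>\<close>: this is where the exponent comes from. Hence
  \<open>e (k + 1) \<le> (1 - \<alpha> k)\<^sup>2 e k + (\<alpha> k) powr (1 + \<theta>) (M + o(1))\<close> with
  \<open>M = (2 c d) powr (1 + \<theta>) * c0 powr (- \<theta>)\<close>
  (lemmas \<open>Halpern_step_le\<close>, \<open>powr_minus_square_le\<close>, \<open>linear_minus_square_le\<close>).

  Rescaling to \<open>w k = e k / (\<alpha> k) powr \<theta>\<close> multiplies the recurrence by the \<open>\<theta>\<close>-th power of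
  \<open>\<alpha> k / \<alpha> (k + 1)\<close>, which by Bernoulli's inequality is at most \<open>1 + \<theta> (L + o(1)) \<alpha> k\<close>. So, up
  to \<open>o(\<alpha> k)\<close>, \<open>w (k + 1) \<le> (1 - (2 - \<theta> L) \<alpha> k) w k + M \<alpha> k\<close>, whose fixed point is
  \<open>M / (2 - \<theta> L)\<close>, the square of the asserted constant
  (lemmas \<open>eventually_le_of_affine_recurrence\<close>, \<open>eventually_le_of_Halpern_recurrence\<close>).
\<close>

section \<open>Recurrences with vanishing step sizes\<close>

lemma powr_le_Bernoulli:
  fixes z \<theta> :: real
  assumes "0 < z" "0 \<le> \<theta>" "\<theta> \<le> 1"
  shows "z powr \<theta> \<le> 1 + \<theta> * (z - 1)"
  using Youngs_inequality_0[of \<theta> "1 - \<theta>" z 1] assms by (simp add: algebra_simps)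

text \<open>
  The excess of \<open>w\<close> over the fixed point \<open>B / \<beta>\<close> is multiplied by at most \<open>1 - \<beta> \<alpha> k\<close> in each
  step. The hypothesis on the ratios keeps \<open>\<alpha>\<close> from decreasing too fast: for small \<open>s > 0\<close>, the
  sequence \<open>\<alpha> k powr s\<close> shrinks more slowly than the excess, and therefore a multiple of it, which
  tends to \<open>0\<close>, bounds the excess from above.
\<close>

lemma eventually_le_of_affine_recurrence:
  fixes \<alpha> w :: "nat \<Rightarrow> real"
  assumes pos: "\<And>k. 0 < \<alpha> k" and lim: "\<alpha> \<longlonglongrightarrow> 0"
    and P: "0 < P" "eventually (\<lambda>k. \<alpha> k / \<alpha> (Suc k) \<le> 1 + P * \<alpha> k) sequentially"
    and \<beta>: "0 < \<beta>"
    and w: "eventually (\<lambda>k. w (Suc k) \<le> (1 - \<beta> * \<alpha> k) * w k + B * \<alpha> k) sequentially"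
    and N: "B / \<beta> < N"
  shows "eventually (\<lambda>k. w k \<le> N) sequentially"
proof -
  \<comment> \<open>\<open>s \<le> 1\<close> makes Bernoulli's inequality applicable, \<open>s P \<le> \<beta>\<close> makes \<open>(1 - \<beta> a) (1 + s P a) \<le> 1\<close>.\<close>
  define s where "s = min 1 (\<beta> / P)"
  have s: "0 < s" "s \<le> 1" "s * P \<le> \<beta>"
    using P(1) \<beta> by (auto simp: s_def min_def field_simps)
  define v where "v k = w k - B / \<beta>" for k
  have "eventually (\<lambda>k. \<alpha> k < 1 / \<beta>) sequentially"
    using lim \<beta> by (intro order_tendstoD) auto
  with P(2) w have "eventually (\<lambda>k. \<alpha> k < 1 / \<beta> \<and> \<alpha> k / \<alpha> (Suc k) \<le> 1 + P * \<alpha> k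
        \<and> w (Suc k) \<le> (1 - \<beta> * \<alpha> k) * w k + B * \<alpha> k) sequentially"
    by eventually_elim (intro conjI)
  then obtain k0 where k0: "\<And>k. k \<ge> k0 \<Longrightarrow> \<alpha> k < 1 / \<beta> \<and> \<alpha> k / \<alpha> (Suc k) \<le> 1 + P * \<alpha> k
        \<and> w (Suc k) \<le> (1 - \<beta> * \<alpha> k) * w k + B * \<alpha> k"
    unfolding eventually_sequentially by blast
  define C where "C = \<bar>v k0\<bar> / \<alpha> k0 powr s"
  have C: "0 \<le> C" using pos by (auto simp: C_def)
  have bound: "v k \<le> C * \<alpha> k powr s" if "k0 \<le> k" for k
    using that
  proof (induction rule: dec_induct)
    case base
    show ?case using pos[of k0] by (simp add: C_def)
  next
    case (step k)
    have le: "0 \<le> 1 - \<beta> * \<alpha> k" using k0[of k] step \<beta> by (auto simp: field_simps)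
    have v': "v (Suc k) \<le> (1 - \<beta> * \<alpha> k) * v k"
    proof -
      have "(1 - \<beta> * \<alpha> k) * v k = (1 - \<beta> * \<alpha> k) * w k + B * \<alpha> k - B / \<beta>"
        using \<beta> by (simp add: v_def field_simps)
      then show ?thesis using k0[of k] step by (simp add: v_def)
    qed
    have "(\<alpha> k / \<alpha> (Suc k)) powr s \<le> 1 + s * (\<alpha> k / \<alpha> (Suc k) - 1)"
      using pos s by (intro powr_le_Bernoulli) auto
    also have "\<dots> \<le> 1 + s * (P * \<alpha> k)"
      using k0[of k] step s by (intro add_left_mono mult_left_mono) auto
    also have "\<dots> \<le> 1 + \<beta> * \<alpha> k"
      using mult_right_mono[OF s(3), of "\<alpha> k"] pos[of k] by (simp add: mult.assoc)
    finally have r: "(\<alpha> k / \<alpha> (Suc k)) powr s \<le> 1 + \<beta> * \<alpha> k" .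
    have "(1 - \<beta> * \<alpha> k) * (\<alpha> k / \<alpha> (Suc k)) powr s \<le> (1 - \<beta> * \<alpha> k) * (1 + \<beta> * \<alpha> k)"
      by (intro mult_left_mono r le)
    also have "\<dots> = 1 - (\<beta> * \<alpha> k)\<^sup>2"
      by (simp add: power2_eq_square algebra_simps)
    also have "\<dots> \<le> 1" by simp
    finally have "(1 - \<beta> * \<alpha> k) * \<alpha> k powr s \<le> \<alpha> (Suc k) powr s"
      using pos[of k] pos[of "Suc k"] by (simp add: powr_divide field_simps)
    then have "C * ((1 - \<beta> * \<alpha> k) * \<alpha> k powr s) \<le> C * \<alpha> (Suc k) powr s"
      by (intro mult_left_mono C)
    moreover have "(1 - \<beta> * \<alpha> k) * v k \<le> (1 - \<beta> * \<alpha> k) * (C * \<alpha> k powr s)"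
      by (intro mult_left_mono le step.IH)
    ultimately show ?case using v' by (simp add: mult.left_commute)
  qed
  have "(\<lambda>k. \<alpha> k powr s) \<longlonglongrightarrow> 0"
    using tendsto_powr'[OF lim tendsto_const, of s] s pos
    by (simp add: less_imp_le)
  then have "(\<lambda>k. C * \<alpha> k powr s) \<longlonglongrightarrow> 0"
    using tendsto_mult_right_zero by blast
  then have "eventually (\<lambda>k. C * \<alpha> k powr s < N - B / \<beta>) sequentially"
    using N by (intro order_tendstoD(2)) auto
  with eventually_ge_at_top[of k0] show ?thesis
    by eventually_elim (use bound in \<open>force simp: v_def\<close>)
qed

text \<open>
  The rescaled sequence \<open>e k / \<alpha> k powr \<theta>\<close> satisfies an affine recurrence for every \<open>\<epsilon> > 0\<close>, with
  fixed point \<open>(1 + \<epsilon>) (M + \<epsilon>) / (2 - \<theta> (l + \<epsilon>) - \<epsilon>)\<close>. This tends to \<open>M / (2 - \<theta> l)\<close> as \<open>\<epsilon>\<close>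
  tends to \<open>0\<close>, so a small enough \<open>\<epsilon>\<close> brings it below the given \<open>N\<close>. The hypotheses on \<open>l\<close> say
  that the limit superior of the increments of \<open>1 / \<alpha>\<close> is at most \<open>l\<close>.
\<close>

lemma eventually_le_of_Halpern_recurrence:
  fixes \<alpha> e r :: "nat \<Rightarrow> real"
  assumes pos: "\<And>k. 0 < \<alpha> k" and lim: "\<alpha> \<longlonglongrightarrow> 0"
    and l: "0 \<le> l" "l < 2"
      "\<And>l'. l < l' \<Longrightarrow> eventually (\<lambda>k. 1 / \<alpha> (Suc k) - 1 / \<alpha> k < l') sequentially"
    and \<theta>: "0 < \<theta>" "\<theta> \<le> 1"
    and e: "\<And>k. 0 \<le> e k"
      "eventually (\<lambda>k. e (Suc k) \<le> (1 - \<alpha> k)\<^sup>2 * e k + \<alpha> k powr (1 + \<theta>) * (M + r k)) sequentially"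
    and r: "r \<longlonglongrightarrow> 0" and M: "0 \<le> M"
    and N: "M / (2 - \<theta> * l) < N"
  shows "eventually (\<lambda>k. e k / \<alpha> k powr \<theta> \<le> N) sequentially"
proof -
  have "\<theta> * l \<le> 1 * l" using \<theta> l by (intro mult_right_mono) auto
  then have D: "\<theta> * l < 2" using l by simp
  have "((\<lambda>\<epsilon>. (1 + \<epsilon>) * (M + \<epsilon>) / (2 - \<theta> * (l + \<epsilon>) - \<epsilon>)) \<longlongrightarrow> (1 + 0) * (M + 0) / (2 - \<theta> * (l + 0) - 0)) (at_right 0)"
    using D by (intro tendsto_intros) auto
  then have ev1: "eventually (\<lambda>\<epsilon>. (1 + \<epsilon>) * (M + \<epsilon>) / (2 - \<theta> * (l + \<epsilon>) - \<epsilon>) < N) (at_right 0)"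
    using N by (intro order_tendstoD) auto
  have "((\<lambda>\<epsilon>. 2 - \<theta> * (l + \<epsilon>) - \<epsilon>) \<longlongrightarrow> 2 - \<theta> * (l + 0) - 0) (at_right 0)"
    by (intro tendsto_intros)
  then have ev2: "eventually (\<lambda>\<epsilon>. 0 < 2 - \<theta> * (l + \<epsilon>) - \<epsilon>) (at_right 0)"
    using D by (intro order_tendstoD) auto
  have "eventually (\<lambda>\<epsilon>. 0 < \<epsilon> \<and> (1 + \<epsilon>) * (M + \<epsilon>) / (2 - \<theta> * (l + \<epsilon>) - \<epsilon>) < N \<and> 0 < 2 - \<theta> * (l + \<epsilon>) - \<epsilon>) (at_right (0::real))"
    using ev1 ev2 eventually_at_right_less by eventually_elim auto
  then obtain \<epsilon> where \<epsilon>: "0 < \<epsilon>" "(1 + \<epsilon>) * (M + \<epsilon>) / (2 - \<theta> * (l + \<epsilon>) - \<epsilon>) < N"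
      "0 < 2 - \<theta> * (l + \<epsilon>) - \<epsilon>"
    using eventually_happens'[OF trivial_limit_at_right_real] by blast
  define P where "P = l + \<epsilon>"
  have P: "0 < P" using l \<epsilon> by (simp add: P_def)
  have "eventually (\<lambda>k. 1 / \<alpha> (Suc k) - 1 / \<alpha> k < P) sequentially"
    using \<epsilon> by (intro l) (simp add: P_def)
  then have ratio: "eventually (\<lambda>k. \<alpha> k / \<alpha> (Suc k) \<le> 1 + P * \<alpha> k) sequentially"
  proof eventually_elim
    case (elim k)
    then have "\<alpha> k * (1 / \<alpha> (Suc k) - 1 / \<alpha> k) \<le> \<alpha> k * P"
      using pos[of k] by (intro mult_left_mono) auto
    then show ?case using pos[of k] by (simp add: algebra_simps)
  qed
  \<comment> \<open>The first bound by \<open>\<epsilon>\<close> absorbs \<open>\<alpha>\<^sup>2\<close> in the contraction factor; the second one gives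
    \<open>1 + \<theta> P \<alpha> \<le> 1 + \<epsilon>\<close> in the additive term.\<close>
  have small: "eventually (\<lambda>k. \<alpha> k < min 1 (min \<epsilon> (\<epsilon> / (\<theta> * P)))) sequentially"
    using lim \<epsilon> P \<theta> by (intro order_tendstoD) auto
  have rsmall: "eventually (\<lambda>k. r k < \<epsilon>) sequentially"
    using r \<epsilon> by (intro order_tendstoD) auto
  show ?thesis
  proof (rule eventually_le_of_affine_recurrence[OF pos lim P ratio, where \<beta> = "2 - \<theta> * P - \<epsilon>"
        and B = "(1 + \<epsilon>) * (M + \<epsilon>)"])
    show "0 < 2 - \<theta> * P - \<epsilon>" "(1 + \<epsilon>) * (M + \<epsilon>) / (2 - \<theta> * P - \<epsilon>) < N"
      using \<epsilon> by (auto simp: P_def)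
    show "eventually (\<lambda>k. e (Suc k) / \<alpha> (Suc k) powr \<theta> \<le> (1 - (2 - \<theta> * P - \<epsilon>) * \<alpha> k) * (e k / \<alpha> k powr \<theta>)
        + (1 + \<epsilon>) * (M + \<epsilon>) * \<alpha> k) sequentially"
      using ratio small rsmall e(2)
    proof eventually_elim
      case (elim k)
      define a where "a = \<alpha> k"
      define q where "q = (a / \<alpha> (Suc k)) powr \<theta>"
      define w where "w = e k / a powr \<theta>"
      have a: "0 < a" "a < 1" "a < \<epsilon>" "\<theta> * P * a \<le> \<epsilon>"
        using elim pos[of k] P \<theta> by (auto simp: a_def field_simps)
      have w: "0 \<le> w" using e(1) by (simp add: w_def)
      have q0: "0 \<le> q" by (simp add: q_def)
      have "q \<le> 1 + \<theta> * (a / \<alpha> (Suc k) - 1)"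
        unfolding q_def using pos \<theta> a by (intro powr_le_Bernoulli) auto
      also have "\<dots> \<le> 1 + \<theta> * (P * a)"
        using elim \<theta> by (intro add_left_mono mult_left_mono) (auto simp: a_def)
      finally have q: "q \<le> 1 + \<theta> * P * a" by (simp add: mult.assoc)
      have "q * (1 - a)\<^sup>2 \<le> (1 + \<theta> * P * a) * (1 - a)\<^sup>2"
        by (intro mult_right_mono q) auto
      also have "\<dots> = 1 - (2 - \<theta> * P) * a + a * a - \<theta> * P * a * a * (2 - a)"
        by (simp add: power2_eq_square algebra_simps)
      also have "\<dots> \<le> 1 - (2 - \<theta> * P) * a + \<epsilon> * a"
      proof -
        have "a * a \<le> \<epsilon> * a" using a by (intro mult_right_mono) auto
        moreover have "0 \<le> \<theta> * P * a * a * (2 - a)" using \<theta> P a by simp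
        ultimately show ?thesis by linarith
      qed
      finally have c1: "q * (1 - a)\<^sup>2 \<le> 1 - (2 - \<theta> * P - \<epsilon>) * a"
        by (simp add: algebra_simps)
      have "q * (M + r k) \<le> q * (M + \<epsilon>)"
        using elim q0 by (intro mult_left_mono) auto
      also have "\<dots> \<le> (1 + \<epsilon>) * (M + \<epsilon>)"
        using q a M \<epsilon> by (intro mult_right_mono) auto
      finally have c2: "q * (M + r k) \<le> (1 + \<epsilon>) * (M + \<epsilon>)" .
      have "e (Suc k) / \<alpha> (Suc k) powr \<theta>
          \<le> ((1 - a)\<^sup>2 * e k + a powr (1 + \<theta>) * (M + r k)) / \<alpha> (Suc k) powr \<theta>"
        using elim by (intro divide_right_mono) (auto simp: a_def)
      also have "\<dots> = q * (1 - a)\<^sup>2 * w + q * (M + r k) * a"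
        using a pos[of "Suc k"] by (simp add: q_def w_def powr_divide powr_add field_simps)
      also have "\<dots> \<le> (1 - (2 - \<theta> * P - \<epsilon>) * a) * w + (1 + \<epsilon>) * (M + \<epsilon>) * a"
        using w a by (intro add_mono mult_right_mono c1 c2) auto
      finally show ?case by (simp add: a_def w_def)
    qed
  qed
qed

section \<open>Optimising over the residual\<close>

text \<open>
  If the left-hand side is positive, the term with \<open>\<delta> powr \<gamma>\<close> exceeds the quadratic one, so that
  \<open>\<delta> powr (2 - \<gamma>) < a b / ((1 - a) c0)\<close>. Dropping the quadratic term and inserting this bound on
  \<open>\<delta>\<close> costs a constant factor compared with the true maximum over \<open>\<delta>\<close>, but yields exactly the
  constant of the convergence rate.
\<close>

lemma powr_minus_square_le:
  fixes a c0 b \<delta> \<gamma> :: real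
  assumes a: "0 < a" "a < 1" and c0: "0 < c0" and b: "0 \<le> b" and \<delta>: "0 \<le> \<delta>"
    and \<gamma>: "0 < \<gamma>" "\<gamma> \<le> 1"
  defines "\<theta> \<equiv> \<gamma> / (2 - \<gamma>)"
  shows "(1 - a) * (a * b * \<delta> powr \<gamma> - (1 - a) * c0 * \<delta>\<^sup>2)
    \<le> a powr (1 + \<theta>) * (b powr (1 + \<theta>) * c0 powr (- \<theta>))"
proof (cases "a * b * \<delta> powr \<gamma> \<le> (1 - a) * c0 * \<delta>\<^sup>2")
  case True
  then have "(1 - a) * (a * b * \<delta> powr \<gamma> - (1 - a) * c0 * \<delta>\<^sup>2) \<le> 0"
    using a by (intro mult_nonneg_nonpos) auto
  then show ?thesis by (rule order_trans) simp
next
  case False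
  have \<theta>: "0 < \<theta>" "\<theta> \<le> 1" using \<gamma> by (auto simp: \<theta>_def field_simps)
  have "\<delta> \<noteq> 0" "b \<noteq> 0" using False a c0 by auto
  then have pos: "0 < \<delta>" "0 < b" using \<delta> b by auto
  have "(1 - a) * c0 * \<delta> powr (2 - \<gamma>) * \<delta> powr \<gamma> < a * b * \<delta> powr \<gamma>"
    using False pos by (simp add: powr_diff)
  then have "(1 - a) * c0 * \<delta> powr (2 - \<gamma>) < a * b"
    by (rule mult_right_less_imp_less) simp
  then have "\<delta> powr (2 - \<gamma>) \<le> a * b / ((1 - a) * c0)"
    using a c0 by (simp add: field_simps)
  then have "(\<delta> powr (2 - \<gamma>)) powr \<theta> \<le> (a * b / ((1 - a) * c0)) powr \<theta>"
    using \<theta> by (intro powr_mono2) auto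
  then have D: "\<delta> powr \<gamma> \<le> (a * b / ((1 - a) * c0)) powr \<theta>"
    using \<gamma> by (simp add: powr_powr \<theta>_def)
  have "(1 - a) * (a * b * \<delta> powr \<gamma> - (1 - a) * c0 * \<delta>\<^sup>2) \<le> (1 - a) * (a * b * \<delta> powr \<gamma>)"
    using a c0 by (intro mult_left_mono) auto
  also have "\<dots> \<le> (1 - a) * (a * b * (a * b / ((1 - a) * c0)) powr \<theta>)"
    using a b by (intro mult_left_mono D) auto
  also have "(a * b / ((1 - a) * c0)) powr \<theta> = a powr \<theta> * b powr \<theta> / ((1 - a) powr \<theta> * c0 powr \<theta>)"
    using a pos c0 by (simp add: powr_divide powr_mult)
  also have "(1 - a) * (a * b * \<dots>) = (1 - a) powr (1 - \<theta>) * (a powr (1 + \<theta>) * (b powr (1 + \<theta>) * c0 powr (- \<theta>)))"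
    using a pos c0 by (simp add: powr_add powr_diff powr_minus field_simps)
  \<comment> \<open>The outer factor \<open>1 - a\<close> pays for the powers of \<open>1 / (1 - a)\<close>, since \<open>\<theta> \<le> 1\<close>.\<close>
  also have "\<dots> \<le> 1 * (a powr (1 + \<theta>) * (b powr (1 + \<theta>) * c0 powr (- \<theta>)))"
    using a \<theta> by (intro mult_right_mono powr_le1) auto
  finally show ?thesis by simp
qed

text \<open>
  For \<open>\<gamma> = 1\<close> the term \<open>a\<^sup>2 d\<^sup>2\<close> from the expansion of the square has the same order as the
  remainder and cannot be neglected. Completing the square gives the exact maximum over \<open>\<delta>\<close>, a
  quarter of the right-hand side; \<open>a\<^sup>2 d\<^sup>2\<close> is at most another quarter because \<open>c0 \<le> 1 \<le> c\<close>.
\<close>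

lemma linear_minus_square_le:
  fixes a c0 c d \<delta> :: real
  assumes a: "0 < a" "a < 1" and c0: "0 < c0" "c0 \<le> 1" and c: "1 \<le> c"
  shows "a\<^sup>2 * d\<^sup>2 + (1 - a) * (a * (2 * c * d) * \<delta> - (1 - a) * c0 * \<delta>\<^sup>2)
    \<le> a\<^sup>2 * ((2 * c * d)\<^sup>2 / c0)"
proof -
  have "0 \<le> ((1 - a) * c0 * \<delta> - a * (c * d))\<^sup>2 / c0"
    using c0 by simp
  also have "\<dots> = (1 - a)\<^sup>2 * c0 * \<delta>\<^sup>2 - (1 - a) * a * (2 * c * d) * \<delta> + a\<^sup>2 * (c * d)\<^sup>2 / c0"
    using c0 by (simp add: power2_eq_square field_simps)
  finally have 1: "(1 - a) * (a * (2 * c * d) * \<delta> - (1 - a) * c0 * \<delta>\<^sup>2) \<le> a\<^sup>2 * ((c * d)\<^sup>2 / c0)"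
    by (simp add: power2_eq_square algebra_simps)
  have "1 \<le> c\<^sup>2" using c by simp
  then have "d\<^sup>2 * 1 \<le> d\<^sup>2 * c\<^sup>2" by (intro mult_left_mono) auto
  then have "d\<^sup>2 \<le> (c * d)\<^sup>2" by (simp add: power_mult_distrib mult.commute)
  also have "\<dots> \<le> (c * d)\<^sup>2 / c0"
    using c0 mult_left_mono[of c0 1 "(c * d)\<^sup>2"] by (simp add: field_simps)
  finally have 2: "a\<^sup>2 * d\<^sup>2 \<le> a\<^sup>2 * ((c * d)\<^sup>2 / c0)"
    by (intro mult_left_mono) auto
  have "0 \<le> a\<^sup>2 * ((c * d)\<^sup>2 / c0)" using c0 by simp
  moreover have "a\<^sup>2 * ((2 * c * d)\<^sup>2 / c0) = 4 * (a\<^sup>2 * ((c * d)\<^sup>2 / c0))"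
    by (simp add: power_mult_distrib)
  ultimately show ?thesis using 1 2 by linarith
qed

section \<open>One step of the iteration\<close>

lemma infdist_eq_dist_closest_point:
  fixes S :: "'a::{real_inner,heine_borel} set"
  assumes "closed S" "S \<noteq> {}"
  shows "infdist x S = dist x (closest_point S x)"
proof (rule antisym)
  show "infdist x S \<le> dist x (closest_point S x)"
    using assms by (intro infdist_le closest_point_in_set)
  obtain s where "s \<in> S" "infdist x S = dist x s"
    using infdist_attains_inf[OF assms] by metis
  then show "dist x (closest_point S x) \<le> infdist x S"
    using closest_point_le[OF assms(1)] by metis
qed

text \<open>
  Split \<open>y - p\<close> at the projection \<open>q\<close> of \<open>y\<close>: the part \<open>q - p\<close> makes an obtuse angle with
  \<open>x - p\<close> by convexity, and the Cauchy-Schwarz inequality treats the part \<open>y - q\<close>.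
\<close>

lemma inner_closest_point_le_infdist:
  fixes S :: "'a::{real_inner,heine_borel} set"
  assumes S: "closed S" "convex S" "S \<noteq> {}"
  shows "(x - closest_point S x) \<bullet> (y - closest_point S x) \<le> infdist x S * infdist y S"
proof -
  let ?p = "closest_point S x" and ?q = "closest_point S y"
  have "(x - ?p) \<bullet> (?q - ?p) \<le> 0"
    using S by (intro closest_point_dot closest_point_in_set)
  moreover have "(x - ?p) \<bullet> (y - ?q) \<le> infdist x S * infdist y S"
    using norm_cauchy_schwarz[of "x - ?p" "y - ?q"] infdist_eq_dist_closest_point[OF S(1,3)]
    by (simp add: dist_norm)
  moreover have "(x - ?p) \<bullet> (y - ?p) = (x - ?p) \<bullet> (y - ?q) + (x - ?p) \<bullet> (?q - ?p)"
    by (simp add: inner_diff_right)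
  ultimately show ?thesis by simp
qed

text \<open>
  Here \<open>t\<close> stands for the image \<open>T y\<close>. The decrease property, applied at the projection of \<open>y\<close>,
  shows that \<open>t\<close> is no farther from \<open>S\<close> than \<open>y\<close>; applied at \<open>p\<close>, it supplies the gain
  \<open>c0 \<delta>\<^sup>2\<close> that competes with the cross term.
\<close>

lemma Halpern_step_le:
  fixes S :: "'a::{real_inner,heine_borel} set" and x y t :: 'a and a c0 \<delta> D :: real
  assumes S: "closed S" "convex S" "S \<noteq> {}"
    and a: "0 < a" "a < 1" and c0: "0 < c0"
    and T: "\<And>s. s \<in> S \<Longrightarrow> (norm (t - s))\<^sup>2 \<le> (norm (y - s))\<^sup>2 - c0 * \<delta>\<^sup>2"
    and D: "infdist y S \<le> D"
  defines "p \<equiv> closest_point S x"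
  shows "(norm (a *\<^sub>R x + (1 - a) *\<^sub>R t - p))\<^sup>2
    \<le> (1 - a)\<^sup>2 * (norm (y - p))\<^sup>2
      + (a\<^sup>2 * (infdist x S)\<^sup>2 + (1 - a) * (a * (2 * infdist x S * D) - (1 - a) * c0 * \<delta>\<^sup>2))"
proof -
  have pS: "p \<in> S" unfolding p_def using S by (intro closest_point_in_set)
  have d: "infdist x S = norm (x - p)"
    using infdist_eq_dist_closest_point[OF S(1,3)] by (simp add: p_def dist_norm)
  have "infdist t S \<le> infdist y S"
  proof -
    let ?q = "closest_point S y"
    have q: "?q \<in> S" using S by (intro closest_point_in_set)
    have "(norm (t - ?q))\<^sup>2 \<le> (norm (y - ?q))\<^sup>2 - c0 * \<delta>\<^sup>2" by (rule T[OF q])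
    also have "\<dots> \<le> (norm (y - ?q))\<^sup>2" using c0 by simp
    finally have "norm (t - ?q) \<le> norm (y - ?q)" by (rule power2_le_imp_le) simp
    then show ?thesis
      using infdist_le[OF q, of t] infdist_eq_dist_closest_point[OF S(1,3), of y] by (simp add: dist_norm)
  qed
  then have "infdist x S * infdist t S \<le> infdist x S * D"
    using D by (intro mult_left_mono infdist_nonneg) auto
  then have I: "(x - p) \<bullet> (t - p) \<le> infdist x S * D"
    using inner_closest_point_le_infdist[OF S, of x t] by (simp add: p_def)
  have expand: "(norm (a *\<^sub>R u + (1 - a) *\<^sub>R v))\<^sup>2
      = a\<^sup>2 * (norm u)\<^sup>2 + 2 * (a * (1 - a)) * (u \<bullet> v) + (1 - a)\<^sup>2 * (norm v)\<^sup>2" for u v :: 'a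
    unfolding power2_norm_eq_inner
    by (simp add: inner_add_left inner_add_right inner_commute[of v u] power2_eq_square algebra_simps)
  have eq: "a *\<^sub>R x + (1 - a) *\<^sub>R t - p = a *\<^sub>R (x - p) + (1 - a) *\<^sub>R (t - p)"
    by (simp add: algebra_simps)
  have "(norm (a *\<^sub>R x + (1 - a) *\<^sub>R t - p))\<^sup>2
      = a\<^sup>2 * (norm (x - p))\<^sup>2 + 2 * (a * (1 - a)) * ((x - p) \<bullet> (t - p)) + (1 - a)\<^sup>2 * (norm (t - p))\<^sup>2"
    unfolding eq by (rule expand)
  also have "\<dots> \<le> a\<^sup>2 * (norm (x - p))\<^sup>2 + 2 * (a * (1 - a)) * (infdist x S * D)
      + (1 - a)\<^sup>2 * ((norm (y - p))\<^sup>2 - c0 * \<delta>\<^sup>2)"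
    using a by (intro add_mono mult_left_mono I T pS) auto
  also have "\<dots> = (1 - a)\<^sup>2 * (norm (y - p))\<^sup>2
      + (a\<^sup>2 * (infdist x S)\<^sup>2 + (1 - a) * (a * (2 * infdist x S * D) - (1 - a) * c0 * \<delta>\<^sup>2))"
    unfolding d by (simp add: power2_eq_square algebra_simps)
  finally show ?thesis .
qed

section \<open>The convergence rate\<close>

text \<open>
  A negative limit superior would make \<open>1 / \<alpha>\<close> eventually decreasing, hence bounded. The lemma
  ensures that the limit superior in the theorem is a nonnegative real number, so that \<^const>\<open>real_of_ereal\<close>
  returns its value and not the default \<open>0\<close> for infinite arguments.
\<close>

lemma limsup_reciprocal_increments_nonneg:
  fixes \<alpha> :: "nat \<Rightarrow> real"
  assumes pos: "\<And>k. 0 < \<alpha> k" and lim: "\<alpha> \<longlonglongrightarrow> 0"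
  shows "0 \<le> limsup (\<lambda>k. ereal (1 / \<alpha> (Suc k) - 1 / \<alpha> k))"
proof (rule ccontr)
  assume "\<not> ?thesis"
  then have "eventually (\<lambda>k. ereal (1 / \<alpha> (Suc k) - 1 / \<alpha> k) < 0) sequentially"
    by (intro Limsup_lessD) auto
  then obtain k0 where k0: "\<And>k. k \<ge> k0 \<Longrightarrow> 1 / \<alpha> (Suc k) \<le> 1 / \<alpha> k"
    unfolding eventually_sequentially by (force simp: zero_ereal_def)
  have le: "\<alpha> k0 \<le> \<alpha> k" if "k0 \<le> k" for k
    using that
  proof (induction rule: dec_induct)
    case (step k)
    then show ?case using k0[of k] pos[of k] pos[of "Suc k"] by (simp add: field_simps)
  qed simp
  have "eventually (\<lambda>k. \<alpha> k < \<alpha> k0) sequentially"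
    using lim pos by (intro order_tendstoD) auto
  with eventually_ge_at_top[of k0] have "eventually (\<lambda>k. False) sequentially"
    by eventually_elim (use le in force)
  then show False by simp
qed

theorem theorem3p5:
  fixes m :: nat
    and U :: "nat \<Rightarrow> (real ^ 'n) set"
    and S K :: "(real ^ 'n) set"
    and T :: "real ^ 'n \<Rightarrow> real ^ 'n"
    and \<alpha> :: "nat \<Rightarrow> real"
    and x :: "real ^ 'n"
    and X :: "nat \<Rightarrow> real ^ 'n"
    and c0 \<gamma> c :: real
    and L :: ereal
  assumes m: "m \<ge> 1"
    and U: "\<And>i. i \<in> {1..m} \<Longrightarrow> closed (U i) \<and> convex (U i)"
    and S: "S = (\<Inter>i\<in>{1..m}. U i)" "S \<noteq> {}"
    and c0: "0 < c0" "c0 \<le> 1"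
    and T: "\<And>s y. s \<in> S \<Longrightarrow>
      (norm (T y - s))\<^sup>2 \<le> (norm (y - s))\<^sup>2 - c0 * (max_infdist m U y)\<^sup>2"
    and \<alpha>_0: "0 < \<alpha> 0" "\<alpha> 0 \<le> 1"
    and \<alpha>_range: "\<And>k. k \<ge> 1 \<Longrightarrow> 0 < \<alpha> k \<and> \<alpha> k \<le> 1"
    and \<alpha>_lim: "\<alpha> \<longlonglongrightarrow> 0"
    and L: "L = limsup (\<lambda>k. ereal (1 / \<alpha> (Suc k) - 1 / \<alpha> k))" "L < 2"
    and \<alpha>_ratio: "(\<lambda>k. \<alpha> k / \<alpha> (Suc k)) \<longlonglongrightarrow> 1"
    and X_0: "X 0 = x"
    and X_Suc: "\<And>k. X (Suc k) = \<alpha> k *\<^sub>R x + (1 - \<alpha> k) *\<^sub>R T (X k)"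
    and \<gamma>: "0 < \<gamma>" "\<gamma> \<le> 1"
    and c: "c \<ge> 1"
    and K: "compact K" "\<And>k. X k \<in> K"
    and error_bound: "\<And>z. z \<in> K \<Longrightarrow> infdist z S \<le> c * max_infdist m U z powr \<gamma>"
  shows "limsup (\<lambda>k. ereal (norm (X k - closest_point S x) / \<alpha> k powr (\<gamma> / (4 - 2 * \<gamma>))))
           \<le> ereal (c0 powr (- \<gamma> / (4 - 2 * \<gamma>))
                     / sqrt (2 - 1 / (2 * inverse \<gamma> - 1) * real_of_ereal L)
                     * (2 * c * infdist x S) powr (1 / (2 - \<gamma>)))
         \<and> (\<lambda>k. norm (X k - closest_point S x)) \<in> O(\<lambda>k. \<alpha> k powr (\<gamma> / (4 - 2 * \<gamma>)))"
proof -
  define p where "p = closest_point S x"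
  define d where "d = infdist x S"
  define \<theta> where "\<theta> = \<gamma> / (2 - \<gamma>)"
  define M where "M = (2 * c * d) powr (1 + \<theta>) * c0 powr (- \<theta>)"
  define e where "e k = (norm (X k - p))\<^sup>2" for k
  \<comment> \<open>For \<open>\<gamma> < 1\<close> we have \<open>\<theta> < 1\<close>, and \<open>a\<^sup>2 d\<^sup>2\<close> is of smaller order than \<open>a powr (1 + \<theta>)\<close>; for
    \<open>\<gamma> = 1\<close> it is already part of the estimate in \<open>linear_minus_square_le\<close>.\<close>
  define r where "r k = (if \<gamma> = 1 then 0 else \<alpha> k powr (1 - \<theta>) * d\<^sup>2)" for k
  have pos: "0 < \<alpha> k" for k using \<alpha>_0 \<alpha>_range[of k] by (cases k) auto
  have closed: "closed S" and convex: "convex S"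
    unfolding S using U by (auto intro!: closed_INT convex_INT)
  have \<theta>: "0 < \<theta>" "\<theta> \<le> 1" using \<gamma> by (auto simp: \<theta>_def field_simps)
  have d0: "0 \<le> d" by (simp add: d_def infdist_nonneg)
  have M0: "0 \<le> M" by (simp add: M_def)

  have "0 \<le> L" unfolding L(1) by (intro limsup_reciprocal_increments_nonneg pos \<alpha>_lim)
  with L(2) obtain l where l: "L = ereal l" "0 \<le> l" "l < 2"
    by (cases L) (auto simp: zero_ereal_def)
  have incr: "eventually (\<lambda>k. 1 / \<alpha> (Suc k) - 1 / \<alpha> k < l') sequentially" if "l < l'" for l'
  proof -
    have "limsup (\<lambda>k. ereal (1 / \<alpha> (Suc k) - 1 / \<alpha> k)) < ereal l'"
      unfolding L(1)[symmetric] l(1) using that by simp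
    then have "eventually (\<lambda>k. ereal (1 / \<alpha> (Suc k) - 1 / \<alpha> k) < ereal l') sequentially"
      by (rule Limsup_lessD)
    then show ?thesis by simp
  qed

  have step: "e (Suc k) \<le> (1 - \<alpha> k)\<^sup>2 * e k + \<alpha> k powr (1 + \<theta>) * (M + r k)" if "\<alpha> k < 1" for k
  proof -
    let ?a = "\<alpha> k" and ?\<delta> = "max_infdist m U (X k)"
    have \<delta>: "0 \<le> ?\<delta>"
    proof -
      have "infdist (X k) (U 1) \<le> ?\<delta>"
        unfolding max_infdist_def using m by (intro Max_ge) auto
      then show ?thesis using infdist_nonneg[of "X k" "U 1"] by linarith
    qed
    have "e (Suc k) \<le> (1 - ?a)\<^sup>2 * e k
        + (?a\<^sup>2 * d\<^sup>2 + (1 - ?a) * (?a * (2 * d * (c * ?\<delta> powr \<gamma>)) - (1 - ?a) * c0 * ?\<delta>\<^sup>2))"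
      unfolding e_def p_def d_def X_Suc
      using that pos S(2) c0 T error_bound[OF K(2)] by (intro Halpern_step_le closed convex) auto
    also have "?a * (2 * d * (c * ?\<delta> powr \<gamma>)) = ?a * (2 * c * d) * ?\<delta> powr \<gamma>"
      by simp
    also have "?a\<^sup>2 * d\<^sup>2 + (1 - ?a) * (?a * (2 * c * d) * ?\<delta> powr \<gamma> - (1 - ?a) * c0 * ?\<delta>\<^sup>2)
        \<le> ?a powr (1 + \<theta>) * (M + r k)"
    proof (cases "\<gamma> = 1")
      case True
      have "\<theta> = 1" using True by (simp add: \<theta>_def)
      then have "?a powr (1 + \<theta>) * (M + r k) = ?a\<^sup>2 * ((2 * c * d)\<^sup>2 / c0)"
        using True pos[of k] c0 c d0 by (simp add: M_def r_def powr_minus field_simps)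
      moreover have "?\<delta> powr \<gamma> = ?\<delta>" using True \<delta> by simp
      ultimately show ?thesis
        using linear_minus_square_le[OF pos[of k] that c0 c, of d ?\<delta>] by simp
    next
      case False
      have "?a powr (1 + \<theta>) * ?a powr (1 - \<theta>) = ?a\<^sup>2"
        using pos[of k] by (simp flip: powr_add)
      then have "?a powr (1 + \<theta>) * (M + r k) = ?a\<^sup>2 * d\<^sup>2 + ?a powr (1 + \<theta>) * M"
        using False by (simp add: r_def distrib_left flip: mult.assoc)
      moreover have "(1 - ?a) * (?a * (2 * c * d) * ?\<delta> powr \<gamma> - (1 - ?a) * c0 * ?\<delta>\<^sup>2) \<le> ?a powr (1 + \<theta>) * M"
        unfolding M_def \<theta>_def using that pos c0 c d0 \<delta> \<gamma> by (intro powr_minus_square_le) auto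
      ultimately show ?thesis by simp
    qed
    finally show ?thesis by simp
  qed
  have "eventually (\<lambda>k. \<alpha> k < 1) sequentially"
    using \<alpha>_lim by (intro order_tendstoD) auto
  then have rec: "eventually (\<lambda>k. e (Suc k) \<le> (1 - \<alpha> k)\<^sup>2 * e k + \<alpha> k powr (1 + \<theta>) * (M + r k)) sequentially"
    by eventually_elim (rule step)
  have r: "r \<longlonglongrightarrow> 0"
  proof (cases "\<gamma> = 1")
    case False
    then have "0 < 1 - \<theta>" using \<gamma> by (simp add: \<theta>_def field_simps)
    then have "(\<lambda>k. \<alpha> k powr (1 - \<theta>)) \<longlonglongrightarrow> 0"
      using tendsto_powr'[OF \<alpha>_lim tendsto_const, of "1 - \<theta>"] pos by (simp add: less_imp_le)
    then have "(\<lambda>k. \<alpha> k powr (1 - \<theta>) * d\<^sup>2) \<longlonglongrightarrow> 0"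
      using tendsto_mult_left_zero by blast
    then show ?thesis using False by (simp add: r_def[abs_def])
  qed (simp add: r_def[abs_def])

  define Q where "Q = c0 powr (- \<gamma> / (4 - 2 * \<gamma>))
                     / sqrt (2 - 1 / (2 * inverse \<gamma> - 1) * real_of_ereal L)
                     * (2 * c * infdist x S) powr (1 / (2 - \<gamma>))"
  have "\<theta> * l \<le> 1 * l" using \<theta> l by (intro mult_right_mono) auto
  then have D: "0 < 2 - \<theta> * l" using l by simp
  have eqs: "\<gamma> / (4 - 2 * \<gamma>) = \<theta> / 2" "- \<gamma> / (4 - 2 * \<gamma>) = - \<theta> / 2" "1 / (2 * inverse \<gamma> - 1) = \<theta>" "1 / (2 - \<gamma>) = (1 + \<theta>) / 2"
    using \<gamma> by (simp_all add: \<theta>_def field_simps)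
  have Q: "Q = c0 powr (- \<theta> / 2) / sqrt (2 - \<theta> * l) * (2 * c * d) powr ((1 + \<theta>) / 2)"
    unfolding Q_def eqs by (simp add: l(1) d_def)
  have Q0: "0 \<le> Q" unfolding Q using D by simp
  have sq: "(z powr (s / 2))\<^sup>2 = z powr s" for z s :: real
    by (simp add: power2_eq_square flip: powr_add)
  have Q2: "Q\<^sup>2 = M / (2 - \<theta> * l)"
    unfolding Q power_mult_distrib power_divide sq using D by (simp add: M_def)
  have main: "eventually (\<lambda>k. norm (X k - p) \<le> y * \<alpha> k powr (\<theta> / 2)) sequentially" if "Q < y" for y
  proof -
    have "Q\<^sup>2 < y\<^sup>2" using that Q0 by (intro power_strict_mono) auto
    then have "eventually (\<lambda>k. e k / \<alpha> k powr \<theta> \<le> y\<^sup>2) sequentially"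
      using \<theta> l M0 Q2 r
      by (intro eventually_le_of_Halpern_recurrence[OF pos \<alpha>_lim l(2,3) incr \<theta> _ rec]) (auto simp: e_def)
    then show ?thesis
    proof eventually_elim
      case (elim k)
      have "(norm (X k - p))\<^sup>2 \<le> (y * \<alpha> k powr (\<theta> / 2))\<^sup>2"
        using elim pos[of k] by (simp add: e_def power_mult_distrib sq field_simps)
      moreover have "0 \<le> y * \<alpha> k powr (\<theta> / 2)" using that Q0 by simp
      ultimately show ?case by (rule power2_le_imp_le)
    qed
  qed
  have "limsup (\<lambda>k. ereal (norm (X k - p) / \<alpha> k powr (\<theta> / 2))) \<le> ereal Q"
  proof (rule ereal_le_epsilon2)
    fix \<eta> :: real assume "0 < \<eta>"
    then have "eventually (\<lambda>k. norm (X k - p) \<le> (Q + \<eta>) * \<alpha> k powr (\<theta> / 2)) sequentially"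
      by (intro main) simp
    then have "eventually (\<lambda>k. ereal (norm (X k - p) / \<alpha> k powr (\<theta> / 2)) \<le> ereal Q + ereal \<eta>) sequentially"
    proof eventually_elim
      case (elim k)
      then show ?case using pos[of k] by (simp add: pos_divide_le_eq)
    qed
    then show "limsup (\<lambda>k. ereal (norm (X k - p) / \<alpha> k powr (\<theta> / 2))) \<le> ereal Q + ereal \<eta>"
      by (rule Limsup_bounded)
  qed
  moreover have "(\<lambda>k. norm (X k - p)) \<in> O(\<lambda>k. \<alpha> k powr (\<theta> / 2))"
    using main[of "Q + 1"] by (intro bigoI[where c = "Q + 1"]) simp
  ultimately show ?thesis
    unfolding p_def Q_def eqs(1) by simp
qed

end
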